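(* Consider a sporadic task system with constrained deadlines scheduled on one processor by a preemptive fixed-priority scheduling algorithm. Let $\tau_k$ be a task with $C_k>0$, let $hp(\tau_k)$ be the set of the $k-1$ tasks with higher priority than $\tau_k$, and assume that these tasks are schedulable. Let $hp_1(\tau_k)=\{\tau_i\in hp(\tau_k): T_i<D_k\}$, $hp_2(\tau_k)=\{\tau_i\in hp(\tau_k):T_i\ge D_k\}$, and $C_k'=C_k+\sum_{\tau_i\in hp_2(\tau_k)}C_i$. Then $\tau_k$ is schedulable by the fixed-priority scheduling algorithm if $$\left(\frac{C_k'}{D_k}+1\right)\prod_{\tau_j\in hp_1(\tau_k)}(U_j+1)\le 2$$ or $$\frac{C_k'}{D_k}+\sum_{\tau_j\in hp_1(\tau_k)}U_j\le k\left(2^{\frac1k}-1\right).$$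
   Context: A sporadic task $\tau_i$ has (worst-case) execution time $C_i>0$ per job, minimum inter-arrival time (period) $T_i$ and relative deadline $D_i$; it releases a sequence of jobs with consecutive releases at least $T_i$ apart, a job released at $r$ has absolute deadline $r+D_i$, and jobs of the same task execute in sequence. Utilization: $U_i=C_i/T_i$. Constrained deadlines: $D_i\le T_i$ for all $i$. Preemptive fixed-priority scheduling on one processor: each task has a priority level, and at any time the ready job of highest priority is executed. A task is schedulable if all of its jobs always finish by their absolute deadlines. $k\ge 2$. *)

theory Defs
  imports "HOL-Analysis.Analysis"
begin

text \<open>
  Tasks are indices, so that distinct tasks may have equal parameters. A numerically smaller
  value of \<open>prio\<close> means a higher priority.
\<close>

record 'a task_system =
  tasks :: "'a set"
  wcet :: "'a \<Rightarrow> real"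
  period :: "'a \<Rightarrow> real"
  rel_deadline :: "'a \<Rightarrow> real"
  prio :: "'a \<Rightarrow> nat"

definition sporadic_task_system :: "'a task_system \<Rightarrow> bool" where
  "sporadic_task_system S \<longleftrightarrow>
     finite (tasks S) \<and>
     (\<forall>i\<in>tasks S. 0 < wcet S i \<and> 0 < period S i \<and> 0 < rel_deadline S i)"

definition constrained_deadlines :: "'a task_system \<Rightarrow> bool" where
  "constrained_deadlines S \<longleftrightarrow> (\<forall>i\<in>tasks S. rel_deadline S i \<le> period S i)"

definition distinct_priorities :: "'a task_system \<Rightarrow> bool" where
  "distinct_priorities S \<longleftrightarrow> inj_on (prio S) (tasks S)"

definition utilization :: "'a task_system \<Rightarrow> 'a \<Rightarrow> real" where
  "utilization S i = wcet S i / period S i"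

definition hp :: "'a task_system \<Rightarrow> 'a \<Rightarrow> 'a set" where
  "hp S k = {i \<in> tasks S. prio S i < prio S k}"

definition hp1 :: "'a task_system \<Rightarrow> 'a \<Rightarrow> 'a set" where
  "hp1 S k = {i \<in> hp S k. period S i < rel_deadline S k}"

definition hp2 :: "'a task_system \<Rightarrow> 'a \<Rightarrow> 'a set" where
  "hp2 S k = {i \<in> hp S k. period S i \<ge> rel_deadline S k}"

definition wcet' :: "'a task_system \<Rightarrow> 'a \<Rightarrow> real" where
  "wcet' S k = wcet S k + (\<Sum>i\<in>hp2 S k. wcet S i)"

text \<open>
  One run-time behaviour of the tasks: how many jobs each task releases (possibly infinitely many),
  when it releases them, and how long each of them actually has to execute. The pair \<open>(i, n)\<close>
  denotes the \<open>n\<close>-th job of task \<open>i\<close>, counted from 0.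
\<close>

record 'a behaviour =
  njobs :: "'a \<Rightarrow> enat"
  release :: "'a \<times> nat \<Rightarrow> real"
  cost :: "'a \<times> nat \<Rightarrow> real"

definition jobs :: "'a task_system \<Rightarrow> 'a behaviour \<Rightarrow> ('a \<times> nat) set" where
  "jobs S b = {(i, n). i \<in> tasks S \<and> enat n < njobs b i}"

definition legal_behaviour :: "'a task_system \<Rightarrow> 'a behaviour \<Rightarrow> bool" where
  "legal_behaviour S b \<longleftrightarrow>
     (\<forall>(i, n) \<in> jobs S b. 0 < cost b (i, n) \<and> cost b (i, n) \<le> wcet S i) \<and>
     (\<forall>i n. (i, Suc n) \<in> jobs S b \<longrightarrow> release b (i, n) + period S i \<le> release b (i, Suc n))"

definition abs_deadline :: "'a task_system \<Rightarrow> 'a behaviour \<Rightarrow> 'a \<times> nat \<Rightarrow> real" where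
  "abs_deadline S b j = release b j + rel_deadline S (fst j)"

text \<open>
  A uniprocessor schedule maps each instant to the job executing at that instant, or to
  \<open>None\<close> if the processor idles.
\<close>

type_synonym 'a schedule = "real \<Rightarrow> ('a \<times> nat) option"

definition service :: "'a behaviour \<Rightarrow> 'a schedule \<Rightarrow> 'a \<times> nat \<Rightarrow> real \<Rightarrow> real" where
  "service b \<sigma> j t = measure lborel {s. release b j \<le> s \<and> s < t \<and> \<sigma> s = Some j}"

definition finished_by :: "'a behaviour \<Rightarrow> 'a schedule \<Rightarrow> 'a \<times> nat \<Rightarrow> real \<Rightarrow> bool" where
  "finished_by b \<sigma> j t \<longleftrightarrow> cost b j \<le> service b \<sigma> j t"

text \<open>The last conjunct makes the jobs of one task execute in sequence.\<close>

definition ready :: "'a task_system \<Rightarrow> 'a behaviour \<Rightarrow> 'a schedule \<Rightarrow> 'a \<times> nat \<Rightarrow> real \<Rightarrow> bool" where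
  "ready S b \<sigma> j t \<longleftrightarrow>
     j \<in> jobs S b \<and> release b j \<le> t \<and> \<not> finished_by b \<sigma> j t \<and>
     (\<forall>m < snd j. finished_by b \<sigma> (fst j, m) t)"

definition fp_schedule :: "'a task_system \<Rightarrow> 'a behaviour \<Rightarrow> 'a schedule \<Rightarrow> bool" where
  "fp_schedule S b \<sigma> \<longleftrightarrow>
     (\<forall>j. {t. \<sigma> t = Some j} \<in> sets borel) \<and>
     (\<forall>t. case \<sigma> t of
            None \<Rightarrow> \<forall>j. \<not> ready S b \<sigma> j t
          | Some j \<Rightarrow> ready S b \<sigma> j t \<and>
              (\<forall>j'. ready S b \<sigma> j' t \<longrightarrow> prio S (fst j) \<le> prio S (fst j')))"

definition schedulable :: "'a task_system \<Rightarrow> 'a \<Rightarrow> bool" where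
  "schedulable S i \<longleftrightarrow>
     (\<forall>b \<sigma>. legal_behaviour S b \<longrightarrow> fp_schedule S b \<sigma> \<longrightarrow>
        (\<forall>n. (i, n) \<in> jobs S b \<longrightarrow> finished_by b \<sigma> (i, n) (abs_deadline S b (i, n))))"

end

theory Submission
  imports Defs
begin

text \<open>
  If a job of \<open>\<tau>\<close> misses its deadline, extend its window back to the latest instant from which the
  processor serves higher-priority work without interruption. No higher-priority work is carried
  into the extended window, so \<open>C + (\<Sum>i. \<lceil>t / T i\<rceil> * C i) > t\<close> for all \<open>t\<close> in \<open>(0, D]\<close>. Evaluating this
  at \<open>D\<close> and at the last multiple of each period below \<open>D\<close>, and chaining the resulting
  inequalities in increasing order of the test points, contradicts the hyperbolic bound; the bound
  on the sum implies the hyperbolic one by the inequality of arithmetic and geometric means.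
\<close>

section \<open>Service received by a job\<close>

text \<open>\<open>measure\<close> maps sets of infinite measure to 0, so services can be compared
  by inclusion only within sets of finite measure; the bounded window provides this.\<close>

lemma executing_measurable:
  assumes "fp_schedule S b \<sigma>"
  shows "{s. u \<le> s \<and> s < t \<and> \<sigma> s = Some j} \<in> fmeasurable lborel"
proof (rule fmeasurableI2)
  have "{s. u \<le> s \<and> s < t \<and> \<sigma> s = Some j} = {u..<t} \<inter> {s. \<sigma> s = Some j}"
    by auto
  moreover have "{s. \<sigma> s = Some j} \<in> sets borel"
    using assms unfolding fp_schedule_def by blast
  ultimately show "{s. u \<le> s \<and> s < t \<and> \<sigma> s = Some j} \<in> sets lborel"
    by simp
  show "{u..t} \<in> fmeasurable lborel"
    by (intro fmeasurable_compact compact_Icc)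
  show "{s. u \<le> s \<and> s < t \<and> \<sigma> s = Some j} \<subseteq> {u..t}"
    by auto
qed

lemma service_mono:
  assumes "fp_schedule S b \<sigma>" and "s \<le> t"
  shows "service b \<sigma> j s \<le> service b \<sigma> j t"
  unfolding service_def
proof (rule measure_mono_fmeasurable)
  show "{x. release b j \<le> x \<and> x < s \<and> \<sigma> x = Some j}
      \<subseteq> {x. release b j \<le> x \<and> x < t \<and> \<sigma> x = Some j}"
    using assms(2) by auto
qed (intro fmeasurableD executing_measurable[OF assms(1)])+

lemma finished_by_mono:
  assumes "fp_schedule S b \<sigma>" and "s \<le> t" and "finished_by b \<sigma> j s"
  shows "finished_by b \<sigma> j t"
  using service_mono[OF assms(1,2), of j] assms(3) unfolding finished_by_def by linarith

lemma executing_imp_ready: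
  assumes "fp_schedule S b \<sigma>" and "\<sigma> s = Some j"
  shows "ready S b \<sigma> j s"
  using assms unfolding fp_schedule_def by (metis (no_types, lifting) option.case(2))

text \<open>
  A job stops executing as soon as its cost is served, so its service just before the supremum
  of its execution times is below its cost.
\<close>

lemma service_le_cost:
  assumes fp: "fp_schedule S b \<sigma>" and pos: "0 < cost b j"
  shows "service b \<sigma> j t \<le> cost b j"
proof (rule field_le_epsilon)
  fix e :: real
  assume e: "0 < e"
  let ?E = "{x. release b j \<le> x \<and> x < t \<and> \<sigma> x = Some j}"
  show "service b \<sigma> j t \<le> cost b j + e"
  proof (cases "?E = {}")
    case True
    have "service b \<sigma> j t = 0"
      unfolding service_def True by simp
    then show ?thesis
      using pos e by simp
  next
    case False
    define u where "u = Sup ?E"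
    have bdd: "bdd_above ?E"
      by (rule bdd_aboveI[of _ t]) auto
    \<comment> \<open>The supremum need not be an execution instant, so one within \<open>e\<close>
      of it is taken. The job is still ready at \<open>s\<close>, hence served less than its cost by
      then, and all later execution fits into an interval of length below \<open>e\<close>.\<close>
    obtain s where s: "s \<in> ?E" "u - e < s"
      using less_cSupE[of "u - e" ?E] False e unfolding u_def by auto
    have su: "s \<le> u"
      unfolding u_def using s(1) bdd by (rule cSup_upper)
    let ?F = "{x. release b j \<le> x \<and> x < s \<and> \<sigma> x = Some j}"
    have "service b \<sigma> j t \<le> measure lborel (?F \<union> {s..u})"
      unfolding service_def
    proof (rule measure_mono_fmeasurable)
      show "?E \<subseteq> ?F \<union> {s..u}"
        unfolding u_def using cSup_upper[OF _ bdd] by force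
      show "?F \<union> {s..u} \<in> fmeasurable lborel"
        by (intro fmeasurable.Un executing_measurable[OF fp] fmeasurable_compact compact_Icc)
    qed (intro fmeasurableD executing_measurable[OF fp])+
    also have "\<dots> \<le> measure lborel ?F + measure lborel {s..u}"
      by (intro measure_Un_le fmeasurableD executing_measurable[OF fp] fmeasurable_compact
          compact_Icc)
    also have "\<dots> = service b \<sigma> j s + (u - s)"
      using su by (simp add: service_def)
    also have "service b \<sigma> j s < cost b j"
      using executing_imp_ready[OF fp, of s j] s(1) unfolding ready_def finished_by_def by simp
    finally show ?thesis
      using s(2) by simp
  qed
qed

section \<open>Releases in a window\<close>

lemma job_predecessor:
  assumes "(i, n) \<in> jobs S b" and "m \<le> n"
  shows "(i, m) \<in> jobs S b"
  using assms unfolding jobs_def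
  by (auto intro: le_less_trans[of "enat m" "enat n"])

lemma release_separation:
  assumes leg: "legal_behaviour S b" and "(i, n) \<in> jobs S b" and "m \<le> n"
  shows "release b (i, m) + real (n - m) * period S i \<le> release b (i, n)"
  using assms(3,2)
proof (induction n rule: dec_induct)
  case base
  show ?case by simp
next
  case (step n)
  have "(i, n) \<in> jobs S b"
    using step.prems by (rule job_predecessor) simp
  moreover have "release b (i, n) + period S i \<le> release b (i, Suc n)"
    using leg step.prems unfolding legal_behaviour_def by blast
  ultimately show ?case
    using step.IH step.hyps by (simp add: Suc_diff_le algebra_simps)
qed

text \<open>Counted from the first job \<open>a\<close> released in the window, every further job
  \<open>n\<close> satisfies (n - a) * T < t, so all indices lie in a block of \<lceil>t / T\<rceil>
  consecutive numbers. The half-open window makes the inequality strict; a closed one could hold one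
  release more.\<close>

lemma releases_in_window:
  fixes u t :: real
  assumes leg: "legal_behaviour S b" and T: "0 < period S i"
  defines "M \<equiv> {n. (i, n) \<in> jobs S b \<and> u \<le> release b (i, n) \<and> release b (i, n) < u + t}"
  shows "finite M" and "card M \<le> nat \<lceil>t / period S i\<rceil>"
proof -
  let ?N = "nat \<lceil>t / period S i\<rceil>"
  have "\<exists>a. M \<subseteq> {a..<a + ?N}"
  proof (cases "M = {}")
    case False
    define a where "a = (LEAST n. n \<in> M)"
    have a: "a \<in> M"
      unfolding a_def using False by (meson LeastI equals0I)
    have "M \<subseteq> {a..<a + ?N}"
    proof
      fix n
      assume n: "n \<in> M"
      then have an: "a \<le> n"
        unfolding a_def by (rule Least_le)
      have "release b (i, a) + real (n - a) * period S i \<le> release b (i, n)"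
        using release_separation[OF leg _ an] n unfolding M_def by blast
      then have "real (n - a) * period S i < t"
        using a n unfolding M_def by auto
      then have "real (n - a) < t / period S i"
        using T by (simp add: field_simps)
      then have "n - a < ?N"
        by linarith
      then show "n \<in> {a..<a + ?N}"
        using an by auto
    qed
    then show ?thesis ..
  qed simp
  then obtain a where a: "M \<subseteq> {a..<a + ?N}" ..
  then show "finite M"
    by (rule finite_subset) simp
  show "card M \<le> ?N"
    using card_mono[OF _ a] by simp
qed

text \<open>Releases up to \<open>r\<close> lie in a window starting at the release of job 0; the
  extra 1 in its length covers a release exactly at \<open>r\<close>. Finiteness is what lets the
  busy window have an earliest candidate start.\<close>

lemma finite_releases_upto:
  assumes leg: "legal_behaviour S b" and T: "0 < period S i"
  shows "finite {n. (i, n) \<in> jobs S b \<and> release b (i, n) \<le> r}"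
proof (rule finite_subset)
  let ?u = "release b (i, 0)"
  show "{n. (i, n) \<in> jobs S b \<and> release b (i, n) \<le> r}
      \<subseteq> {n. (i, n) \<in> jobs S b \<and> ?u \<le> release b (i, n) \<and> release b (i, n) < ?u + (r - ?u + 1)}"
  proof safe
    fix n
    assume "(i, n) \<in> jobs S b"
    from release_separation[OF leg this, of 0] T
    show "?u \<le> release b (i, n)"
      by (smt (verit) mult_nonneg_nonneg of_nat_0_le_iff zero_le)
  qed auto
  show "finite {n. (i, n) \<in> jobs S b \<and> ?u \<le> release b (i, n) \<and> release b (i, n) < ?u + (r - ?u + 1)}"
    using releases_in_window(1)[OF leg T] .
qed

section \<open>The busy window\<close>

text \<open>Job \<open>n\<close> itself may be waiting for its predecessors, but the first
  unfinished job of the same task is ready. So the processor is not idle, and whatever it executes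
  has at least the priority of \<open>i\<close>.\<close>

lemma pending_imp_hp_executing:
  assumes leg: "legal_behaviour S b" and fp: "fp_schedule S b \<sigma>"
    and T: "0 < period S i"
    and i: "i \<in> hp S \<tau>" and j: "(i, n) \<in> jobs S b"
    and rel: "release b (i, n) \<le> s" and unf: "\<not> finished_by b \<sigma> (i, n) s"
  shows "\<exists>j. \<sigma> s = Some j \<and> fst j \<in> hp S \<tau>"
proof -
  define m where "m = (LEAST m. \<not> finished_by b \<sigma> (i, m) s)"
  have m: "\<not> finished_by b \<sigma> (i, m) s"
    unfolding m_def by (rule LeastI, rule unf)
  have mn: "m \<le> n"
    unfolding m_def by (rule Least_le, rule unf)
  have "release b (i, m) \<le> release b (i, n)"
    using release_separation[OF leg j mn] T
    by (smt (verit) mult_nonneg_nonneg of_nat_0_le_iff)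
  moreover have "\<forall>m'<m. finished_by b \<sigma> (i, m') s"
    unfolding m_def using not_less_Least by blast
  ultimately have rdy: "ready S b \<sigma> (i, m) s"
    unfolding ready_def using job_predecessor[OF j mn] rel m by auto
  show ?thesis
  proof (cases "\<sigma> s")
    case None
    then show ?thesis
      using fp rdy unfolding fp_schedule_def by (metis (no_types, lifting) option.case(1))
  next
    case (Some j')
    have "prio S (fst j') \<le> prio S i"
      using fp rdy Some unfolding fp_schedule_def
      by (smt (verit, ccfv_threshold) fst_conv option.case(2))
    moreover have "fst j' \<in> tasks S"
      using executing_imp_ready[OF fp Some] unfolding ready_def jobs_def by auto
    ultimately show ?thesis
      using Some i unfolding hp_def by auto
  qed
qed

text \<open>The start is the earliest suitable candidate. A higher-priority job released before
  \<open>u\<close> and unfinished at \<open>u\<close> would have kept such work executing since its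
  release, which would then be an earlier candidate.\<close>

lemma busy_window_start:
  assumes leg: "legal_behaviour S b" and fp: "fp_schedule S b \<sigma>"
    and fin: "finite (tasks S)" and T: "\<And>i. i \<in> tasks S \<Longrightarrow> 0 < period S i"
  obtains u where "u \<le> r"
    and "\<And>s. u \<le> s \<Longrightarrow> s < r \<Longrightarrow> \<exists>j. \<sigma> s = Some j \<and> fst j \<in> hp S \<tau>"
    and "\<And>j. j \<in> jobs S b \<Longrightarrow> fst j \<in> hp S \<tau> \<Longrightarrow> release b j < u \<Longrightarrow> finished_by b \<sigma> j u"
proof -
  define J where "J = {j \<in> jobs S b. fst j \<in> hp S \<tau> \<and> release b j \<le> r}"
  define busy where
    "busy u \<longleftrightarrow> (\<forall>s. u \<le> s \<and> s < r \<longrightarrow> (\<exists>j. \<sigma> s = Some j \<and> fst j \<in> hp S \<tau>))" for u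
  \<comment> \<open>Only \<open>r\<close> and the releases up to \<open>r\<close> are candidates, so
    the set is finite and has a minimum; \<open>r\<close> itself qualifies vacuously.\<close>
  define B where "B = {u \<in> insert r (release b ` J). busy u}"
  have "J \<subseteq> Sigma (tasks S) (\<lambda>i. {n. (i, n) \<in> jobs S b \<and> release b (i, n) \<le> r})"
    unfolding J_def hp_def by auto
  moreover have "finite (Sigma (tasks S) (\<lambda>i. {n. (i, n) \<in> jobs S b \<and> release b (i, n) \<le> r}))"
    using fin finite_releases_upto[OF leg T] by blast
  ultimately have "finite J"
    by (rule finite_subset)
  then have finB: "finite B"
    unfolding B_def by simp
  have "r \<in> B"
    unfolding B_def busy_def by auto
  define u where "u = Min B"
  have u: "u \<in> B"
    unfolding u_def using finB \<open>r \<in> B\<close> by (intro Min_in) auto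
  have ur: "u \<le> r"
    unfolding u_def using finB \<open>r \<in> B\<close> by simp
  have "finished_by b \<sigma> j u"
    if j: "j \<in> jobs S b" "fst j \<in> hp S \<tau>" "release b j < u" for j
  proof (rule ccontr)
    assume unf: "\<not> finished_by b \<sigma> j u"
    have "busy (release b j)"
      unfolding busy_def
    proof (intro allI impI)
      fix s
      assume s: "release b j \<le> s \<and> s < r"
      show "\<exists>j. \<sigma> s = Some j \<and> fst j \<in> hp S \<tau>"
      proof (cases "u \<le> s")
        case True
        then show ?thesis
          using u s unfolding B_def busy_def by blast
      next
        case False
        then have "\<not> finished_by b \<sigma> j s"
          using unf finished_by_mono[OF fp, of s u j] by auto
        then show ?thesis
          using pending_imp_hp_executing[OF leg fp, of "fst j" \<tau> "snd j" s] j s T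
          by (simp add: hp_def)
      qed
    qed
    then have "release b j \<in> B"
      using j ur unfolding B_def J_def by auto
    then have "u \<le> release b j"
      unfolding u_def using finB by simp
    then show False
      using j by simp
  qed
  with that[of u] ur u show thesis
    unfolding B_def busy_def by blast
qed

text \<open>Throughout the window of length \<open>t\<close> from the busy start \<open>u\<close>
  the processor executes either job \<open>n\<close> of \<tau> or a higher-priority job released
  inside that window. The window length is therefore at most the total service of these jobs, and
  counting releases per task gives the ceilings. The window begins at \<open>u\<close> rather than
  at the release \<open>r\<close>, but \<open>u \<le> r\<close> keeps its end within
  \<open>r + D\<close>.\<close>

lemma unfinished_imp_time_demand:
  assumes leg: "legal_behaviour S b" and fp: "fp_schedule S b \<sigma>"
    and sys: "sporadic_task_system S" and dist: "distinct_priorities S"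
    and job: "(\<tau>, n) \<in> jobs S b"
    and prev: "\<And>m. m < n \<Longrightarrow> finished_by b \<sigma> (\<tau>, m) (release b (\<tau>, n))"
    and unf: "\<not> finished_by b \<sigma> (\<tau>, n) (release b (\<tau>, n) + D)"
    and t: "0 < t" "t \<le> D"
  shows "t < wcet S \<tau> + (\<Sum>i\<in>hp S \<tau>. real_of_int \<lceil>t / period S i\<rceil> * wcet S i)"
proof -
  define r where "r = release b (\<tau>, n)"
  have fin: "finite (tasks S)" and T: "\<And>i. i \<in> tasks S \<Longrightarrow> 0 < period S i"
    and C: "\<And>i. i \<in> tasks S \<Longrightarrow> 0 < wcet S i"
    using sys unfolding sporadic_task_system_def by auto
  have \<tau>: "\<tau> \<in> tasks S"
    using job unfolding jobs_def by auto
  have cost: "0 < cost b j \<and> cost b j \<le> wcet S (fst j)" if "j \<in> jobs S b" for j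
    using leg that unfolding legal_behaviour_def by (cases j) auto
  obtain u where ur: "u \<le> r"
    and busy: "\<And>s. u \<le> s \<Longrightarrow> s < r \<Longrightarrow> \<exists>j. \<sigma> s = Some j \<and> fst j \<in> hp S \<tau>"
    and clear: "\<And>j. j \<in> jobs S b \<Longrightarrow> fst j \<in> hp S \<tau> \<Longrightarrow> release b j < u \<Longrightarrow> finished_by b \<sigma> j u"
    using busy_window_start[OF leg fp fin T, where r = r and \<tau> = \<tau>] by blast
  define M where
    "M i = {n. (i, n) \<in> jobs S b \<and> u \<le> release b (i, n) \<and> release b (i, n) < u + t}" for i
  define J where "J = Sigma (hp S \<tau>) M"
  define E where "E j = {s. release b j \<le> s \<and> s < u + t \<and> \<sigma> s = Some j}" for j
  have finhp: "finite (hp S \<tau>)"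
    using fin unfolding hp_def by simp
  have Tpos: "0 < period S i" and Cpos: "0 < wcet S i" if "i \<in> hp S \<tau>" for i
    using that T C unfolding hp_def by auto
  have finM: "finite (M i)" and cardM: "card (M i) \<le> nat \<lceil>t / period S i\<rceil>"
    if "i \<in> hp S \<tau>" for i
    using releases_in_window[OF leg Tpos[OF that], of u t] unfolding M_def by auto
  have finJ: "finite J"
    unfolding J_def using finhp finM by blast
  \<comment> \<open>A higher-priority job released before \<open>u\<close> is finished at
    \<open>u\<close>, so one executing later must have been released in the window.\<close>
  have hpJ: "j \<in> J" if "\<sigma> s = Some j" "fst j \<in> hp S \<tau>" "u \<le> s" "s < u + t" for s j
  proof -
    have rdy: "ready S b \<sigma> j s"
      using fp that(1) by (rule executing_imp_ready)
    have "u \<le> release b j"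
      using rdy clear[of j] that finished_by_mono[OF fp, of u s j] unfolding ready_def
      by fastforce
    with rdy that show ?thesis
      unfolding J_def M_def ready_def by (cases j) auto
  qed
  have runs: "\<exists>j\<in>insert (\<tau>, n) J. \<sigma> s = Some j" if s: "u \<le> s" "s < u + t" for s
  proof (cases "s < r")
    case True
    then show ?thesis
      using busy[OF s(1)] hpJ s by blast
  next
    \<comment> \<open>From \<open>r\<close> on, job \<open>n\<close> is ready, since its
      predecessors are finished and it stays unfinished up to \<open>r + D\<close>. The executing
      job thus has at least the priority of \<tau>.\<close>
    case False
    have "s \<le> r + D"
      using s ur t by simp
    then have "\<not> finished_by b \<sigma> (\<tau>, n) s"
      using unf finished_by_mono[OF fp] unfolding r_def by blast
    moreover have "finished_by b \<sigma> (\<tau>, m) s" if "m < n" for m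
      using finished_by_mono[OF fp _ prev[OF that]] False unfolding r_def by simp
    ultimately have rdy: "ready S b \<sigma> (\<tau>, n) s"
      using job False unfolding ready_def r_def by auto
    then obtain j where j: "\<sigma> s = Some j"
      using fp unfolding fp_schedule_def by (metis (no_types, lifting) option.case(1) not_Some_eq)
    have rdyj: "ready S b \<sigma> j s"
      using fp j by (rule executing_imp_ready)
    have prio: "prio S (fst j) \<le> prio S \<tau>"
      using fp rdy j unfolding fp_schedule_def
      by (smt (verit, ccfv_threshold) fst_conv option.case(2))
    have jt: "fst j \<in> tasks S"
      using rdyj unfolding ready_def jobs_def by auto
    show ?thesis
    proof (cases "fst j = \<tau>")
      case True
      \<comment> \<open>Of two ready jobs of one task, the later one would require the earlier one
        to be finished.\<close>
      have "snd j = n"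
        using rdy rdyj True unfolding ready_def
        by (metis fst_conv linorder_neqE_nat prod.collapse snd_conv)
      then show ?thesis
        using True j by (metis insertI1 prod.collapse)
    next
      case False
      then have "prio S (fst j) \<noteq> prio S \<tau>"
        using dist jt \<tau> unfolding distinct_priorities_def inj_on_def by blast
      then have "fst j \<in> hp S \<tau>"
        using prio jt unfolding hp_def by simp
      then show ?thesis
        using hpJ[OF j] s j by blast
    qed
  qed
  have sub: "{u..<u + t} \<subseteq> (\<Union>j\<in>insert (\<tau>, n) J. E j)"
  proof
    fix s
    assume "s \<in> {u..<u + t}"
    then have s: "u \<le> s" "s < u + t"
      by auto
    obtain j where j: "j \<in> insert (\<tau>, n) J" "\<sigma> s = Some j"
      using runs[OF s] by blast
    have "s \<in> E j"
      using executing_imp_ready[OF fp j(2)] s j(2) unfolding E_def ready_def by simp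
    then show "s \<in> (\<Union>j\<in>insert (\<tau>, n) J. E j)"
      using j by blast
  qed
  have measE: "E j \<in> fmeasurable lborel" for j
    unfolding E_def using fp by (rule executing_measurable)
  have srv: "measure lborel (E j) = service b \<sigma> j (u + t)" for j
    unfolding E_def service_def ..
  have notin: "(\<tau>, n) \<notin> J"
    unfolding J_def hp_def by auto
  have "t = measure lborel {u..<u + t}"
    using t by simp
  also have "\<dots> \<le> measure lborel (\<Union>j\<in>insert (\<tau>, n) J. E j)"
    using sub _ fmeasurable.finite_UN[OF _ measE]
    by (rule measure_mono_fmeasurable) (use finJ in auto)
  also have "\<dots> \<le> (\<Sum>j\<in>insert (\<tau>, n) J. measure lborel (E j))"
    using finJ by (intro measure_UNION_le fmeasurableD measE) simp
  also have "\<dots> = service b \<sigma> (\<tau>, n) (u + t) + (\<Sum>j\<in>J. service b \<sigma> j (u + t))"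
    using finJ notin by (simp add: srv)
  \<comment> \<open>Strictness comes from job \<open>n\<close>, which has received less than its
    cost; the other jobs never receive more than theirs.\<close>
  also have "\<dots> < wcet S \<tau> + (\<Sum>j\<in>J. wcet S (fst j))"
  proof (rule add_less_le_mono)
    have "\<not> finished_by b \<sigma> (\<tau>, n) (u + t)"
      using unf finished_by_mono[OF fp, of "u + t" "r + D"] ur t unfolding r_def by auto
    then show "service b \<sigma> (\<tau>, n) (u + t) < wcet S \<tau>"
      using cost[OF job] unfolding finished_by_def by simp
    show "(\<Sum>j\<in>J. service b \<sigma> j (u + t)) \<le> (\<Sum>j\<in>J. wcet S (fst j))"
    proof (rule sum_mono)
      fix j
      assume "j \<in> J"
      then have "j \<in> jobs S b"
        unfolding J_def M_def by auto
      then show "service b \<sigma> j (u + t) \<le> wcet S (fst j)"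
        using service_le_cost[OF fp, of j "u + t"] cost[of j] by linarith
    qed
  qed
  also have "(\<Sum>j\<in>J. wcet S (fst j)) = (\<Sum>i\<in>hp S \<tau>. real (card (M i)) * wcet S i)"
    using sum.Sigma[of "hp S \<tau>" M "\<lambda>i _. wcet S i"] finhp finM by (simp add: J_def split_def)
  also have "\<dots> \<le> (\<Sum>i\<in>hp S \<tau>. real_of_int \<lceil>t / period S i\<rceil> * wcet S i)"
  proof (intro sum_mono mult_right_mono)
    fix i
    assume i: "i \<in> hp S \<tau>"
    have "0 \<le> \<lceil>t / period S i\<rceil>"
      using t Tpos[OF i] by (simp add: le_ceiling_iff less_le_trans[of _ 0])
    then show "real (card (M i)) \<le> real_of_int \<lceil>t / period S i\<rceil>"
      using cardM[OF i] by linarith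
    show "0 \<le> wcet S i"
      using Cpos[OF i] by simp
  qed
  finally show ?thesis
    by simp
qed

section \<open>The utilization bounds\<close>

text \<open>Indices are added in increasing order of \<open>x\<close>. The bound for the newest one
  says that \<open>x y\<close> is at most the total so far, so adding \<open>x y * U y\<close>
  multiplies the bound on that total by at most \<open>U y + 1\<close>.\<close>

lemma sum_le_prod_of_ordered_bounds:
  fixes x U :: "'a \<Rightarrow> real"
  assumes "finite I" and "\<And>i. i \<in> I \<Longrightarrow> 0 \<le> x i" and "\<And>i. i \<in> I \<Longrightarrow> 0 \<le> U i"
    and "\<And>j. j \<in> I \<Longrightarrow> x j \<le> A + (\<Sum>i\<in>{i\<in>I. x i < x j}. x i * U i)"
  shows "A + (\<Sum>i\<in>I. x i * U i) \<le> A * (\<Prod>i\<in>I. U i + 1)"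
  using assms
proof (induction I rule: finite_ranking_induct[where f = x])
  case empty
  show ?case by simp
next
  case (insert y I)
  show ?case
  proof (cases "y \<in> I")
    case True
    then show ?thesis
      using insert by (simp add: insert_absorb)
  next
    case False
    have IH: "A + (\<Sum>i\<in>I. x i * U i) \<le> A * (\<Prod>i\<in>I. U i + 1)"
    proof (rule insert.IH)
      fix j
      assume j: "j \<in> I"
      \<comment> \<open>As \<open>x y\<close> is maximal, \<open>y\<close> never occurs in the sums
        of the earlier indices, whose bounds therefore carry over to \<open>I\<close>.\<close>
      then have "{i \<in> insert y I. x i < x j} = {i \<in> I. x i < x j}"
        using insert.hyps(2)[of j] by auto
      then show "x j \<le> A + (\<Sum>i\<in>{i\<in>I. x i < x j}. x i * U i)"
        using insert.prems(3)[of j] j by simp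
    qed (use insert.prems in auto)
    have "x y \<le> A + (\<Sum>i\<in>{i\<in>insert y I. x i < x y}. x i * U i)"
      by (rule insert.prems(3)) simp
    also have "{i\<in>insert y I. x i < x y} = {i\<in>I. x i < x y}"
      by auto
    also have "A + (\<Sum>i\<in>{i\<in>I. x i < x y}. x i * U i) \<le> A + (\<Sum>i\<in>I. x i * U i)"
      using insert.hyps(1) insert.prems by (intro add_left_mono sum_mono2) auto
    also have "\<dots> \<le> A * (\<Prod>i\<in>I. U i + 1)"
      by (rule IH)
    finally have "x y * U y \<le> A * (\<Prod>i\<in>I. U i + 1) * U y"
      using insert.prems(2)[of y] by (intro mult_right_mono) auto
    then show ?thesis
      using IH False insert.hyps(1) by (simp add: algebra_simps)
  qed
qed

text \<open>
  The demand is tested at \<open>D\<close> and at the last multiple \<open>x i\<close> of each period before \<open>D\<close>. Up to the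
  test point \<open>x j\<close>, task \<open>i\<close> has at most \<open>x i / T i\<close> releases if \<open>x j \<le> x i\<close>, and at most one more
  otherwise; since \<open>T i \<le> x i\<close>, that extra release costs at most another \<open>x i * U i\<close>.
\<close>

lemma hyperbolic_bound_of_time_demand:
  fixes C T :: "'a \<Rightarrow> real" and C' D :: real
  assumes fin: "finite I" and D: "0 < D" and C': "0 < C'"
    and T: "\<And>i. i \<in> I \<Longrightarrow> 0 < T i" and TD: "\<And>i. i \<in> I \<Longrightarrow> T i < D"
    and C: "\<And>i. i \<in> I \<Longrightarrow> 0 < C i"
    and demand: "\<And>t. 0 < t \<Longrightarrow> t \<le> D \<Longrightarrow> t < C' + (\<Sum>i\<in>I. real_of_int \<lceil>t / T i\<rceil> * C i)"
  shows "2 < (C' / D + 1) * (\<Prod>i\<in>I. C i / T i + 1)"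
proof -
  \<comment> \<open>The ceiling minus 1, rather than the floor, keeps the test point
    \<open>x i\<close> strictly below \<open>D\<close> even when \<open>D\<close> is a multiple of
    \<open>T i\<close>.\<close>
  define g where "g i = real_of_int \<lceil>D / T i\<rceil> - 1" for i
  define x where "x i = g i * T i" for i
  define U where "U i = C i / T i" for i
  \<comment> \<open>Since \<open>x i * U i = g i * C i\<close>, this is \<open>C'\<close> plus the
    cost of \<open>g i\<close> jobs of each task, that is, one job fewer than the demand at
    \<open>D\<close> counts.\<close>
  define A where "A = C' + (\<Sum>i\<in>I. x i * U i)"
  define P where "P = (\<Prod>i\<in>I. U i + 1)"
  have U: "0 < U i" if "i \<in> I" for i
    using T[OF that] C[OF that] by (simp add: U_def)
  have g: "1 \<le> g i" if "i \<in> I" for i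
  proof -
    have "1 < D / T i"
      using T[OF that] TD[OF that] by simp
    then have "1 < \<lceil>D / T i\<rceil>"
      by (simp add: less_ceiling_iff)
    then show ?thesis
      unfolding g_def by linarith
  qed
  have xU: "x i * U i = g i * C i" if "i \<in> I" for i
    using T[OF that] by (simp add: x_def U_def)
  have xpos: "0 < x i" if "i \<in> I" for i
    using g[OF that] T[OF that] by (simp add: x_def)
  have xD: "x i < D" if "i \<in> I" for i
  proof -
    have "g i < D / T i"
      unfolding g_def by linarith
    then show ?thesis
      using T[OF that] by (simp add: x_def field_simps)
  qed
  have double: "real_of_int \<lceil>t / T i\<rceil> * C i \<le> 2 * (x i * U i)" if i: "i \<in> I" and t: "t \<le> D" for t i
  proof -
    have "\<lceil>t / T i\<rceil> \<le> \<lceil>D / T i\<rceil>"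
      using T[OF i] t by (intro ceiling_mono divide_right_mono) auto
    then have "real_of_int \<lceil>t / T i\<rceil> \<le> g i + 1"
      by (simp add: g_def)
    also have "\<dots> \<le> 2 * g i"
      using g[OF i] by simp
    finally have "real_of_int \<lceil>t / T i\<rceil> * C i \<le> 2 * g i * C i"
      using C[OF i] by (intro mult_right_mono) auto
    then show ?thesis
      using xU[OF i] by simp
  qed
  have single: "real_of_int \<lceil>t / T i\<rceil> * C i \<le> x i * U i" if i: "i \<in> I" and t: "t \<le> x i" for t i
  proof -
    have "t / T i \<le> real_of_int (\<lceil>D / T i\<rceil> - 1)"
      using t T[OF i] by (simp add: x_def g_def pos_divide_le_eq)
    then have "\<lceil>t / T i\<rceil> \<le> \<lceil>D / T i\<rceil> - 1"
      by (rule ceiling_le)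
    then have "real_of_int \<lceil>t / T i\<rceil> \<le> g i"
      unfolding g_def by linarith
    then have "real_of_int \<lceil>t / T i\<rceil> * C i \<le> g i * C i"
      using C[OF i] by (intro mult_right_mono) auto
    then show ?thesis
      using xU[OF i] by simp
  qed
  have "A + (\<Sum>i\<in>I. x i * U i) \<le> A * P"
    unfolding P_def
  proof (rule sum_le_prod_of_ordered_bounds[OF fin])
    fix j
    assume j: "j \<in> I"
    have "x j \<le> C' + (\<Sum>i\<in>I. real_of_int \<lceil>x j / T i\<rceil> * C i)"
      using demand[of "x j"] xpos[OF j] xD[OF j] by simp
    also have "\<dots> \<le> C' + (\<Sum>i\<in>I. x i * U i + (if x i < x j then x i * U i else 0))"
    proof (intro add_left_mono sum_mono)
      fix i
      assume i: "i \<in> I"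
      show "real_of_int \<lceil>x j / T i\<rceil> * C i \<le> x i * U i + (if x i < x j then x i * U i else 0)"
        using double[OF i, of "x j"] single[OF i, of "x j"] xD[OF j] by (cases "x i < x j") (simp_all add: mult_ac)
    qed
    also have "\<dots> = A + (\<Sum>i\<in>{i\<in>I. x i < x j}. x i * U i)"
      using fin by (simp add: A_def sum.distrib sum.inter_filter)
    finally show "x j \<le> A + (\<Sum>i\<in>{i\<in>I. x i < x j}. x i * U i)" .
  qed (simp_all add: xpos U less_imp_le)
  then have 1: "2 * A - C' \<le> A * P"
    by (simp add: A_def)
  have "(\<Sum>i\<in>I. real_of_int \<lceil>D / T i\<rceil> * C i) \<le> (\<Sum>i\<in>I. 2 * (x i * U i))"
    by (intro sum_mono double) auto
  then have 2: "D < 2 * A - C'"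
    using demand[of D] D by (simp add: A_def sum_distrib_left)
  have "2 * D < (C' + D) * P"
  \<comment> \<open>It remains to eliminate \<open>A\<close>. For \<open>P < 2\<close>, fact
    \<open>2\<close> may be multiplied by \<open>2 - P\<close>, and fact \<open>1\<close> in the
    form \<open>A * (2 - P) \<le> C'\<close> bounds the result by \<open>C' * P\<close>. For larger
    \<open>P\<close> the claim is immediate.\<close>
  proof (cases "2 \<le> P")
    case True
    then have "(C' + D) * 2 \<le> (C' + D) * P"
      using C' D by (intro mult_left_mono) auto
    then show ?thesis
      using C' by simp
  next
    case False
    have "D * (2 - P) < (2 * A - C') * (2 - P)"
      using 2 False by (intro mult_strict_right_mono) auto
    also have "\<dots> \<le> C' * P"
      using 1 by (simp add: algebra_simps)
    finally show ?thesis
      by (simp add: algebra_simps)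
  qed
  then have "2 < (C' + D) * P / D"
    using D by (simp add: field_simps)
  also have "\<dots> = (C' / D + 1) * P"
    using D by (simp add: field_simps)
  finally show ?thesis
    unfolding P_def U_def .
qed

text \<open>This is the inequality of arithmetic and geometric means for the numbers
  \<open>y i + 1\<close>, raised to the power \<open>card I\<close>.\<close>

lemma prod_add_one_le_power:
  fixes y :: "'a \<Rightarrow> real"
  assumes "finite I" and "I \<noteq> {}" and nonneg: "\<And>i. i \<in> I \<Longrightarrow> 0 \<le> y i"
  shows "(\<Prod>i\<in>I. y i + 1) \<le> (1 + (\<Sum>i\<in>I. y i) / card I) ^ card I"
proof -
  let ?k = "card I"
  have k: "0 < ?k"
    using assms(1,2) by (simp add: card_gt_0_iff)
  have pos: "0 < (\<Prod>i\<in>I. y i + 1)"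
    using nonneg by (intro prod_pos) (simp add: add_nonneg_pos)
  have "(\<Prod>i\<in>I. y i + 1) powr (1 / ?k) \<le> (\<Sum>i\<in>I. (y i + 1) / ?k)"
    using assms by (intro arith_geom_mean) (auto simp: add_nonneg_nonneg)
  also have "\<dots> = 1 + (\<Sum>i\<in>I. y i) / ?k"
    using k by (simp add: add_divide_distrib sum.distrib flip: sum_divide_distrib)
  finally have "((\<Prod>i\<in>I. y i + 1) powr (1 / ?k)) ^ ?k \<le> (1 + (\<Sum>i\<in>I. y i) / ?k) ^ ?k"
    by (rule power_mono) simp
  also have "((\<Prod>i\<in>I. y i + 1) powr (1 / ?k)) ^ ?k = (\<Prod>i\<in>I. y i + 1)"
    using pos k by (simp add: powr_powr flip: powr_realpow)
  finally show ?thesis .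
qed

theorem theorem1:
  fixes S :: "'a task_system" and \<tau> :: 'a and k :: nat
  assumes "sporadic_task_system S"
    and "constrained_deadlines S"
    and "distinct_priorities S"
    and "k \<ge> 2"
    and "\<tau> \<in> tasks S"
    and "wcet S \<tau> > 0"
    and "card (hp S \<tau>) = k - 1"
    and "\<forall>i\<in>hp S \<tau>. schedulable S i"
    and "(wcet' S \<tau> / rel_deadline S \<tau> + 1) * (\<Prod>j\<in>hp1 S \<tau>. utilization S j + 1) \<le> 2
       \<or> wcet' S \<tau> / rel_deadline S \<tau> + (\<Sum>j\<in>hp1 S \<tau>. utilization S j)
           \<le> real k * (2 powr (1 / real k) - 1)"
  shows "schedulable S \<tau>"
proof -
  let ?D = "rel_deadline S \<tau>" and ?I = "hp1 S \<tau>"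
  have fin: "finite (tasks S)"
    and pos: "\<And>i. i \<in> tasks S \<Longrightarrow> 0 < wcet S i \<and> 0 < period S i \<and> 0 < rel_deadline S i"
    using assms(1) unfolding sporadic_task_system_def by auto
  have D: "0 < ?D"
    using pos assms(5) by blast
  have finhp: "finite (hp S \<tau>)"
    using fin unfolding hp_def by simp
  have hp: "hp S \<tau> = ?I \<union> hp2 S \<tau>" "?I \<inter> hp2 S \<tau> = {}"
    unfolding hp1_def hp2_def by auto
  have fin12: "finite ?I" "finite (hp2 S \<tau>)"
    using finhp hp(1) by auto
  have hppos: "0 < wcet S i \<and> 0 < period S i" if "i \<in> hp S \<tau>" for i
    using that pos unfolding hp_def by auto
  have C': "0 < wcet' S \<tau>"
    unfolding wcet'_def using assms(6) hppos hp(1)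
    by (intro add_pos_nonneg sum_nonneg) (auto simp: less_imp_le)
  have U: "0 \<le> utilization S i" if "i \<in> ?I" for i
    using that hppos hp(1) by (auto simp: utilization_def less_imp_le)
  have bound: "(wcet' S \<tau> / ?D + 1) * (\<Prod>j\<in>?I. utilization S j + 1) \<le> 2"
    using assms(9)
  proof
    assume LL: "wcet' S \<tau> / ?D + (\<Sum>j\<in>?I. utilization S j) \<le> real k * (2 powr (1 / real k) - 1)"
    \<comment> \<open>The sum bound has exponent \<open>k\<close>, the number of all tasks in
      \<open>?K\<close>, while the product ranges over \<open>hp1\<close> only. Giving the tasks of
      \<open>hp2\<close> the value 0 pads it to \<open>k\<close> factors without changing the
      product or the sum.\<close>
    define y where "y i = (if i = \<tau> then wcet' S \<tau> / ?D else if i \<in> ?I then utilization S i else 0)"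
      for i
    let ?K = "insert \<tau> (hp S \<tau>)"
    have \<tau>: "\<tau> \<notin> hp S \<tau>"
      unfolding hp_def by simp
    have card: "card ?K = k"
      using \<tau> finhp assms(4,7) by simp
    have y: "y i = utilization S i" if "i \<in> ?I" for i
      using that \<tau> hp(1) unfolding y_def by auto
    have y2: "y i = 0" if "i \<in> hp S \<tau> - ?I" for i
      using that \<tau> unfolding y_def by auto
    have "(\<Sum>i\<in>hp S \<tau>. y i) = (\<Sum>i\<in>?I. y i)"
      using finhp hp(1) y2 by (intro sum.mono_neutral_right) auto
    then have sumy: "(\<Sum>i\<in>?K. y i) = wcet' S \<tau> / ?D + (\<Sum>j\<in>?I. utilization S j)"
      using \<tau> finhp y by (simp add: y_def[of \<tau>])
    have "(\<Prod>i\<in>hp S \<tau>. y i + 1) = (\<Prod>i\<in>?I. y i + 1)"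
      using finhp hp(1) y2 by (intro prod.mono_neutral_right) auto
    then have "(wcet' S \<tau> / ?D + 1) * (\<Prod>j\<in>?I. utilization S j + 1) = (\<Prod>i\<in>?K. y i + 1)"
      using \<tau> finhp y by (simp add: y_def[of \<tau>])
    also have "\<dots> \<le> (1 + (\<Sum>i\<in>?K. y i) / card ?K) ^ card ?K"
    proof (rule prod_add_one_le_power)
      show "0 \<le> y i" for i
        using U C' D unfolding y_def by auto
    qed (use finhp in auto)
    also have "\<dots> = (1 + (wcet' S \<tau> / ?D + (\<Sum>j\<in>?I. utilization S j)) / k) ^ k"
      unfolding card sumy ..
    also have "\<dots> \<le> (2 powr (1 / k)) ^ k"
    proof (rule power_mono)
      have "(wcet' S \<tau> / ?D + (\<Sum>j\<in>?I. utilization S j)) / k \<le> 2 powr (1 / real k) - 1"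
        using LL assms(4) by (simp add: pos_divide_le_eq mult.commute)
      then show "1 + (wcet' S \<tau> / ?D + (\<Sum>j\<in>?I. utilization S j)) / k \<le> 2 powr (1 / k)"
        by simp
      show "0 \<le> 1 + (wcet' S \<tau> / ?D + (\<Sum>j\<in>?I. utilization S j)) / k"
        using C' D U by (intro add_nonneg_nonneg divide_nonneg_nonneg sum_nonneg) auto
    qed
    also have "\<dots> = 2"
      using assms(4) by (simp add: powr_powr flip: powr_realpow)
    finally show ?thesis .
  qed
  show ?thesis
    unfolding schedulable_def
  proof (intro allI impI)
    fix b \<sigma> n
    assume leg: "legal_behaviour S b" and fp: "fp_schedule S b \<sigma>" and job: "(\<tau>, n) \<in> jobs S b"
    from job show "finished_by b \<sigma> (\<tau>, n) (abs_deadline S b (\<tau>, n))"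
    proof (induction n rule: less_induct)
      case (less n)
      \<comment> \<open>By induction the earlier job meets its deadline, and since the deadline is
        at most the period, this lies no later than the release of job \<open>n\<close>. So no work
        of \<tau> itself is carried over.\<close>
      have prev: "finished_by b \<sigma> (\<tau>, m) (release b (\<tau>, n))" if "m < n" for m
      proof (rule finished_by_mono[OF fp])
        show "finished_by b \<sigma> (\<tau>, m) (abs_deadline S b (\<tau>, m))"
          using less.IH[OF that] job_predecessor[OF less.prems] that by simp
        have "?D \<le> period S \<tau>"
          using assms(2,5) unfolding constrained_deadlines_def by blast
        also have "\<dots> \<le> real (n - m) * period S \<tau>"
          using that pos[OF assms(5)] by simp
        finally show "abs_deadline S b (\<tau>, m) \<le> release b (\<tau>, n)"
          using release_separation[OF leg less.prems, of m] that unfolding abs_deadline_def by simp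
      qed
      show ?case
      proof (rule ccontr)
        assume "\<not> finished_by b \<sigma> (\<tau>, n) (abs_deadline S b (\<tau>, n))"
        then have unf: "\<not> finished_by b \<sigma> (\<tau>, n) (release b (\<tau>, n) + ?D)"
          by (simp add: abs_deadline_def)
        have "2 < (wcet' S \<tau> / ?D + 1) * (\<Prod>i\<in>?I. wcet S i / period S i + 1)"
        proof (rule hyperbolic_bound_of_time_demand[OF fin12(1) D C'])
          fix t
          assume t: "0 < t" "t \<le> ?D"
          let ?d = "\<lambda>i. real_of_int \<lceil>t / period S i\<rceil> * wcet S i"
          have "t < wcet S \<tau> + (\<Sum>i\<in>hp S \<tau>. ?d i)"
            using unfinished_imp_time_demand[OF leg fp assms(1,3) less.prems prev unf t] .
          also have "(\<Sum>i\<in>hp S \<tau>. ?d i) = (\<Sum>i\<in>?I. ?d i) + (\<Sum>i\<in>hp2 S \<tau>. ?d i)"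
            unfolding hp(1) using fin12 hp(2) by (rule sum.union_disjoint)
          \<comment> \<open>Here \<open>t \<le> D \<le> T i\<close>, so the ceiling is at most 1:
            each task of \<open>hp2\<close> contributes at most one job, whose cost is absorbed into
            \<open>wcet'\<close>.\<close>
          also have "(\<Sum>i\<in>hp2 S \<tau>. ?d i) \<le> (\<Sum>i\<in>hp2 S \<tau>. wcet S i)"
          proof (rule sum_mono)
            fix i
            assume i: "i \<in> hp2 S \<tau>"
            have "0 < wcet S i" "0 < period S i" "?D \<le> period S i"
              using i hppos unfolding hp2_def by auto
            then show "?d i \<le> wcet S i"
              using t by (simp add: ceiling_le_iff)
          qed
          finally show "t < wcet' S \<tau> + (\<Sum>i\<in>?I. ?d i)"
            by (simp add: wcet'_def)
        qed (use hppos in \<open>auto simp: hp1_def\<close>)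
        then show False
          using bound by (simp add: utilization_def)
      qed
    qed
  qed
qed

end
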